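(* For every $\eta\in(0,1)$ there is an $M$ such that for all integers $a,b$ with $\min(a,b)\ge M$, writing $n=a+b$, the lattice path Markov chain on paths in the $a\times b$ rectangle satisfies $d(t)\ge 1-\eta$ for every integer $0\le t\le \frac{1-\eta}{\pi^2}\,n^3\log\min(a,b)$. (That is, if $\min(a,b)\gg 1$, then after $\frac{1-o(1)}{\pi^2}n^3\log\min(a,b)$ steps the variation distance from stationarity is $1-o(1)$.)
   Context: Lattice paths in the $a\times b$ rectangle are binary strings of length $n=a+b$ with exactly $a$ zeros and $b$ ones. The lattice path Markov chain: at each step choose one of the $n-1$ adjacent pairs of positions uniformly at random and flip a fair coin; if heads sort the two letters in that pair (increasing order), otherwise reverse-sort them (decreasing order). The stationary distribution is uniform. $d(t)=\max_x\|P_x^t-U\|_{TV}$, where $P_x^t$ is the law at time $t$ of the chain started from $x$, $U$ is the uniform distribution, and $\|\cdot\|_{TV}=\frac12\|\cdot\|_1$. $\log$ is the natural logarithm. *)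

theory Defs
  imports "HOL-Probability.Probability"
begin

text \<open>Letters are Booleans: \<^term>\<open>False\<close> is the letter 0 and \<^term>\<open>True\<close> is the letter 1,
  so the order on letters is \<^term>\<open>False < True\<close>. Positions are numbered from 0.\<close>

definition lattice_paths :: "nat \<Rightarrow> nat \<Rightarrow> bool list set" where
  "lattice_paths a b =
     {xs. length xs = a + b \<and> count_list xs False = a \<and> count_list xs True = b}"

definition sort_pair :: "nat \<Rightarrow> bool list \<Rightarrow> bool list" where
  "sort_pair i xs =
     xs[i := min (xs ! i) (xs ! Suc i), Suc i := max (xs ! i) (xs ! Suc i)]"

definition reverse_sort_pair :: "nat \<Rightarrow> bool list \<Rightarrow> bool list" where
  "reverse_sort_pair i xs =
     xs[i := max (xs ! i) (xs ! Suc i), Suc i := min (xs ! i) (xs ! Suc i)]"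

text \<open>The \<^term>\<open>length xs - 1\<close> adjacent pairs are indexed by their left position. The step is
  meaningful only for strings of length at least 2, since \<^const>\<open>pmf_of_set\<close> is unspecified on
  the empty set.\<close>

definition path_step :: "bool list \<Rightarrow> bool list pmf" where
  "path_step xs =
     bind_pmf (pmf_of_set {..<length xs - 1}) (\<lambda>i.
     bind_pmf (bernoulli_pmf (1/2)) (\<lambda>heads.
     return_pmf (if heads then sort_pair i xs else reverse_sort_pair i xs)))"

primrec path_law :: "bool list \<Rightarrow> nat \<Rightarrow> bool list pmf" where
  "path_law x 0 = return_pmf x"
| "path_law x (Suc t) = bind_pmf (path_law x t) path_step"

definition tv_dist :: "'a pmf \<Rightarrow> 'a pmf \<Rightarrow> real" where
  "tv_dist p q = (\<Sum>\<^sub>\<infinity>x. \<bar>pmf p x - pmf q x\<bar>) / 2"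

definition path_dist :: "nat \<Rightarrow> nat \<Rightarrow> nat \<Rightarrow> real" where
  "path_dist a b t =
     (MAX x\<in>lattice_paths a b. tv_dist (path_law x t) (pmf_of_set (lattice_paths a b)))"

text \<open>The maximum and the uniform distribution are taken over a finite nonempty set.\<close>

lemma finite_lattice_paths: "finite (lattice_paths a b)"
proof (rule finite_subset)
  show "lattice_paths a b \<subseteq> {xs. set xs \<subseteq> UNIV \<and> length xs = a + b}"
    by (auto simp: lattice_paths_def)
  show "finite {xs :: bool list. set xs \<subseteq> UNIV \<and> length xs = a + b}"
    by (rule finite_lists_length_eq) simp
qed

lemma lattice_paths_nonempty: "lattice_paths a b \<noteq> {}"
proof -
  have "count_list (replicate n x) y = (if x = y then n else 0)" for n and x y :: bool
    by (induction n) auto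
  then have "replicate a False @ replicate b True \<in> lattice_paths a b"
    by (simp add: lattice_paths_def)
  then show ?thesis by blast
qed

end

theory Submission
  imports Defs
begin

text \<open>Wilson's method. Write \<open>n = a + b\<close>, \<open>m = min a b\<close>, and let \<open>h\<^sub>i\<close> be the number of ones among the
  first \<open>i\<close> letters, minus its average \<open>i b / n\<close>. A step at the pair around \<open>i\<close> replaces \<open>h\<^sub>i\<close> on average
  by \<open>(h\<^sub>i\<^sub>-\<^sub>1 + h\<^sub>i\<^sub>+\<^sub>1) / 2\<close>, so \<open>\<Phi> = \<Sum>\<^sub>i sin (\<pi> i / n) h\<^sub>i\<close> is an eigenfunction with eigenvalue
  \<open>1 - \<gamma>\<close>, where \<open>\<gamma> = (1 - cos (\<pi> / n)) / (n - 1)\<close> is about \<open>\<pi>\<^sup>2 / (2 n\<^sup>3)\<close>. A path has at most \<open>2 m\<close>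
  letter changes, so a step changes \<open>\<Phi>\<close> by at most \<open>m / (n - 1)\<close> in mean square; hence the variance
  of \<open>\<Phi>\<close> is \<open>O(m n\<^sup>2)\<close> at all times and under the uniform distribution. From the path with all ones
  first, \<open>\<Phi>\<close> starts at order \<open>m n\<close>, so its mean at time \<open>t\<close> exceeds the standard deviation by a factor
  of order \<open>(1 - \<gamma>)\<^sup>t \<surd>m\<close>, which is large up to \<open>t = (1 - \<eta>) n\<^sup>3 ln m / \<pi>\<^sup>2\<close>. Chebyshev's inequality then
  separates the two laws.\<close>

section \<open>One step as a lazy transposition; stationarity of the uniform law\<close>

definition swap_pair :: "nat \<Rightarrow> bool list \<Rightarrow> bool list" where
  "swap_pair i xs = xs[i := xs ! Suc i, Suc i := xs ! i]"

lemma length_swap_pair [simp]: "length (swap_pair i xs) = length xs"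
  by (simp add: swap_pair_def)

lemma nth_swap_pair:
  assumes "Suc i < length xs" "j < length xs"
  shows "swap_pair i xs ! j = (if j = i then xs ! Suc i else if j = Suc i then xs ! i else xs ! j)"
  using assms by (auto simp: swap_pair_def nth_list_update)

lemma swap_pair_swap_pair:
  assumes "Suc i < length xs"
  shows "swap_pair i (swap_pair i xs) = xs"
  using assms by (intro nth_equalityI) (simp_all add: nth_swap_pair)

lemma swap_pair_mem:
  assumes "xs \<in> lattice_paths a b" "Suc i < a + b"
  shows "swap_pair i xs \<in> lattice_paths a b"
proof -
  have len: "length xs = a + b" using assms by (simp add: lattice_paths_def)
  have "mset (swap_pair i xs) = mset xs"
    unfolding swap_pair_def using assms(2) len by (intro mset_swap) auto
  then have "count_list (swap_pair i xs) y = count_list xs y" for y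
    by (metis count_mset)
  then show ?thesis using assms by (simp add: lattice_paths_def)
qed

text \<open>Whatever the order of the two letters, one of the two sorts changes nothing and the
  other exchanges them. With a fair coin the step is therefore a lazy transposition.\<close>

lemma sort_pair_cases:
  assumes "Suc i < length xs"
  shows "sort_pair i xs = xs \<and> reverse_sort_pair i xs = swap_pair i xs \<or>
         sort_pair i xs = swap_pair i xs \<and> reverse_sort_pair i xs = xs"
proof (cases "xs ! i \<le> xs ! Suc i")
  case True
  then show ?thesis
    by (simp add: sort_pair_def reverse_sort_pair_def swap_pair_def min_def max_def)
next
  case False
  then have "xs ! i" "\<not> xs ! Suc i" by auto
  then show ?thesis
    by (auto simp add: sort_pair_def reverse_sort_pair_def swap_pair_def min_def max_def)
       (metis list_update_id)+
qed

lemma expectation_path_step: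
  fixes f :: "bool list \<Rightarrow> real"
  assumes "length xs \<ge> 2"
  shows "measure_pmf.expectation (path_step xs) f =
    (\<Sum>i<length xs - 1. (f xs + f (swap_pair i xs)) / 2) / real (length xs - 1)"
proof -
  define flip where "flip i = bernoulli_pmf (1/2) \<bind>
     (\<lambda>heads. return_pmf (if heads then sort_pair i xs else reverse_sort_pair i xs))" for i
  have ne: "{..<length xs - 1} \<noteq> {}" using assms by (auto simp: lessThan_empty_iff)
  have fin: "finite (set_pmf (flip i))" for i
    by (auto simp: flip_def)
  have flip: "measure_pmf.expectation (flip i) f = (f xs + f (swap_pair i xs)) / 2"
    if "i < length xs - 1" for i
  proof -
    have "measure_pmf.expectation (flip i) f = (f (sort_pair i xs) + f (reverse_sort_pair i xs)) / 2"
      unfolding flip_def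
      by (subst pmf_expectation_bind[where A = UNIV]) (auto simp: UNIV_bool field_simps)
    moreover have "Suc i < length xs" using that by simp
    ultimately show ?thesis using sort_pair_cases[of i xs] by (auto simp: add.commute)
  qed
  have step: "path_step xs = pmf_of_set {..<length xs - 1} \<bind> flip"
    by (simp add: path_step_def flip_def[abs_def])
  have "measure_pmf.expectation (path_step xs) f
     = (\<Sum>i<length xs - 1. measure_pmf.expectation (flip i) f / real (length xs - 1))"
    unfolding step using ne fin
    by (subst pmf_expectation_bind[where A = "{..<length xs - 1}"]) (auto simp: divide_inverse mult.commute)
  then show ?thesis by (simp add: flip sum_divide_distrib)
qed

lemma set_path_step:
  assumes "xs \<in> lattice_paths a b" "a + b \<ge> 2"
  shows "set_pmf (path_step xs) \<subseteq> lattice_paths a b"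
proof -
  have len: "length xs = a + b" using assms by (simp add: lattice_paths_def)
  have "sort_pair i xs \<in> lattice_paths a b \<and> reverse_sort_pair i xs \<in> lattice_paths a b"
    if "i < length xs - 1" for i
  proof -
    have "Suc i < a + b" using that len by simp
    then show ?thesis
      using sort_pair_cases[of i xs] swap_pair_mem[OF assms(1), of i] assms len by auto
  qed
  moreover have "{..<length xs - 1} \<noteq> {}" using assms len by (auto simp: lessThan_empty_iff)
  ultimately show ?thesis by (auto simp: path_step_def split: if_splits)
qed

lemma set_path_law:
  assumes "x \<in> lattice_paths a b" "a + b \<ge> 2"
  shows "set_pmf (path_law x t) \<subseteq> lattice_paths a b"
  using assms by (induction t) (use set_path_step in \<open>force+\<close>)

text \<open>At each position the exchange is an involution of the set of paths, so it preserves the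
  sum of any function over that set. Stationarity later turns the one-step moment recursion into a
  second moment bound under the uniform law.\<close>

lemma uniform_stationary:
  fixes a b :: nat
  assumes "a + b \<ge> 2"
  defines "U \<equiv> pmf_of_set (lattice_paths a b)"
  shows "bind_pmf U path_step = U"
proof (rule pmf_eqI)
  fix z
  let ?S = "lattice_paths a b" and ?n = "a + b"
  let ?f = "indicator {z} :: bool list \<Rightarrow> real"
  note fin = finite_lattice_paths[of a b] and ne = lattice_paths_nonempty[of a b]
  have len: "length x = ?n" if "x \<in> ?S" for x using that by (simp add: lattice_paths_def)
  have swap: "(\<Sum>x\<in>?S. ?f (swap_pair i x)) = (\<Sum>x\<in>?S. ?f x)" if "i < ?n - 1" for i
    by (rule sum.reindex_bij_witness[of _ "swap_pair i" "swap_pair i"])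
       (use that swap_pair_mem swap_pair_swap_pair len in auto)
  have "measure_pmf.expectation (bind_pmf U path_step) ?f
      = (\<Sum>x\<in>?S. measure_pmf.expectation (path_step x) ?f / card ?S)"
    unfolding U_def using fin ne finite_subset[OF set_path_step[OF _ assms(1)] fin]
    by (subst pmf_expectation_bind[where A = ?S]) (auto simp: divide_inverse mult.commute)
  also have "\<dots> = (\<Sum>x\<in>?S. (\<Sum>i<?n - 1. (?f x + ?f (swap_pair i x)) / 2) / real (?n - 1) / card ?S)"
    using assms(1) by (intro sum.cong refl) (subst expectation_path_step, simp_all add: len)
  also have "\<dots> = (\<Sum>i<?n - 1. ((\<Sum>x\<in>?S. ?f x) + (\<Sum>x\<in>?S. ?f (swap_pair i x))) / 2) / real (?n - 1) / card ?S"
    unfolding sum_divide_distrib[symmetric] sum.distrib[symmetric]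
    by (subst sum.swap) (simp add: sum_divide_distrib)
  also have "\<dots> = (\<Sum>i<?n - 1. (\<Sum>x\<in>?S. ?f x)) / real (?n - 1) / card ?S"
    by (simp add: swap del: sum_constant)
  also have "\<dots> = (\<Sum>x\<in>?S. ?f x) / card ?S"
    using assms(1) by (simp del: sum_indicator_eq_card)
  also have "\<dots> = measure_pmf.expectation U ?f"
    unfolding U_def using fin ne by (subst integral_pmf_of_set) simp_all
  finally show "pmf (bind_pmf U path_step) z = pmf U z"
    by (simp add: pmf.rep_eq)
qed

section \<open>Total variation bounds from moments; moment recursion of an eigenfunction\<close>

text \<open>The differences \<open>pmf p x - pmf q x\<close> sum to zero, so their sums over
  \<open>A\<close> and over its complement are opposite, and the l1 norm is at least twice the
  former.\<close>

lemma tv_dist_ge_diff: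
  assumes "finite S" "set_pmf p \<subseteq> S" "set_pmf q \<subseteq> S"
  shows "measure_pmf.prob p A - measure_pmf.prob q A \<le> tv_dist p q"
proof -
  let ?d = "\<lambda>x. pmf p x - pmf q x"
  have out: "pmf p x = 0" "pmf q x = 0" if "x \<notin> S" for x
    using that assms by (auto simp: pmf_eq_0_set_pmf)
  have "tv_dist p q = (\<Sum>\<^sub>\<infinity>x\<in>S. \<bar>?d x\<bar>) / 2"
    unfolding tv_dist_def by (intro arg_cong2[where f="(/)"] infsum_cong_neutral) (auto simp: out)
  then have tv: "tv_dist p q = (\<Sum>x\<in>S. \<bar>?d x\<bar>) / 2" using assms(1) by simp
  have m: "measure_pmf.prob r A = (\<Sum>x\<in>S \<inter> A. pmf r x)" if "set_pmf r \<subseteq> S" for r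
  proof -
    have "measure_pmf.prob r A = measure_pmf.prob r (S \<inter> A)"
      by (rule measure_eq_AE) (use that in \<open>auto simp: AE_measure_pmf_iff\<close>)
    then show ?thesis using assms(1) by (simp add: measure_measure_pmf_finite)
  qed
  have "(\<Sum>x\<in>S. ?d x) = 0"
    using assms by (simp add: sum_subtractf sum_pmf_eq_1)
  moreover have "(\<Sum>x\<in>S. ?d x) = (\<Sum>x\<in>S \<inter> A. ?d x) + (\<Sum>x\<in>S - A. ?d x)"
    using assms(1) by (subst sum.Int_Diff[where B = A]) auto
  moreover have "(\<Sum>x\<in>S. \<bar>?d x\<bar>) = (\<Sum>x\<in>S \<inter> A. \<bar>?d x\<bar>) + (\<Sum>x\<in>S - A. \<bar>?d x\<bar>)"
    using assms(1) by (subst sum.Int_Diff[where B = A]) auto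
  moreover have "(\<Sum>x\<in>S \<inter> A. ?d x) \<le> (\<Sum>x\<in>S \<inter> A. \<bar>?d x\<bar>)" by (intro sum_mono) auto
  moreover have "- (\<Sum>x\<in>S - A. ?d x) \<le> (\<Sum>x\<in>S - A. \<bar>?d x\<bar>)"
    unfolding sum_negf[symmetric] by (intro sum_mono) auto
  ultimately have "2 * (\<Sum>x\<in>S \<inter> A. ?d x) \<le> (\<Sum>x\<in>S. \<bar>?d x\<bar>)" by linarith
  then show ?thesis using assms tv by (simp add: m sum_subtractf)
qed

text \<open>The test event is \<Phi> \<ge> \<mu> / 2. By Chebyshev it fails under \<open>p\<close>,
  and it holds under \<open>q\<close>, with probability at most 4 V / \<mu>^2 each.\<close>

lemma tv_dist_ge_second_moment:
  fixes \<Phi> :: "'a \<Rightarrow> real"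
  assumes fin: "finite S" "set_pmf p \<subseteq> S" "set_pmf q \<subseteq> S"
    and mean: "measure_pmf.expectation p \<Phi> = \<mu>" "\<mu> > 0"
    and p2: "measure_pmf.expectation p (\<lambda>x. (\<Phi> x)\<^sup>2) \<le> \<mu>\<^sup>2 + V"
    and q2: "measure_pmf.expectation q (\<lambda>x. (\<Phi> x)\<^sup>2) \<le> V"
  shows "tv_dist p q \<ge> 1 - 8 * V / \<mu>\<^sup>2"
proof -
  let ?A = "{x. \<Phi> x \<ge> \<mu> / 2}"
  have "finite (set_pmf p)" "finite (set_pmf q)" using fin finite_subset by auto
  note [simp] = integrable_measure_pmf_finite[OF this(1)] integrable_measure_pmf_finite[OF this(2)]
  \<comment> \<open>Pointwise Chebyshev bound, used with \<open>y\<close> equal to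
    \<open>\<Phi> x\<close> under \<open>q\<close> and to \<open>\<Phi> x - \<mu>\<close> under
    \<open>p\<close>.\<close>
  have far: "1 \<le> 4 * y\<^sup>2 / \<mu>\<^sup>2" if "\<bar>y\<bar> \<ge> \<mu> / 2" for y
  proof -
    have "(\<mu> / 2)\<^sup>2 \<le> y\<^sup>2" using that mean(2) by (metis abs_ge_zero abs_of_pos half_gt_zero power2_abs power_mono less_imp_le)
    then show ?thesis using mean(2) by (simp add: field_simps power2_eq_square)
  qed
  have "measure_pmf.prob q ?A = measure_pmf.expectation q (indicator ?A)" by simp
  also have "\<dots> \<le> measure_pmf.expectation q (\<lambda>x. 4 * (\<Phi> x)\<^sup>2 / \<mu>\<^sup>2)"
    by (intro integral_mono) (auto simp: indicator_def intro!: far)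
  also have "\<dots> = 4 / \<mu>\<^sup>2 * measure_pmf.expectation q (\<lambda>x. (\<Phi> x)\<^sup>2)"
    by (subst integral_mult_right_zero[symmetric]) simp
  also have "\<dots> \<le> 4 / \<mu>\<^sup>2 * V" by (intro mult_left_mono q2) auto
  finally have Q: "measure_pmf.prob q ?A \<le> 4 / \<mu>\<^sup>2 * V" .
  have "measure_pmf.prob p (- ?A) = measure_pmf.expectation p (indicator (- ?A))" by simp
  also have "\<dots> \<le> measure_pmf.expectation p (\<lambda>x. 4 * (\<Phi> x - \<mu>)\<^sup>2 / \<mu>\<^sup>2)"
    by (intro integral_mono) (auto simp: indicator_def abs_if intro!: far)
  also have "\<dots> = 4 / \<mu>\<^sup>2 * measure_pmf.expectation p (\<lambda>x. (\<Phi> x)\<^sup>2 - 2 * \<mu> * \<Phi> x + \<mu>\<^sup>2)"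
    by (subst integral_mult_right_zero[symmetric])
       (auto intro!: Bochner_Integration.integral_cong simp: power2_diff mult_ac)
  also have "measure_pmf.expectation p (\<lambda>x. (\<Phi> x)\<^sup>2 - 2 * \<mu> * \<Phi> x + \<mu>\<^sup>2)
      = measure_pmf.expectation p (\<lambda>x. (\<Phi> x)\<^sup>2) - \<mu>\<^sup>2"
    using mean by (simp add: power2_eq_square)
  also have "4 / \<mu>\<^sup>2 * \<dots> \<le> 4 / \<mu>\<^sup>2 * V" by (intro mult_left_mono) (use p2 in auto)
  finally have "measure_pmf.prob p (- ?A) \<le> 4 / \<mu>\<^sup>2 * V" .
  moreover have "measure_pmf.prob p (- ?A) = 1 - measure_pmf.prob p ?A"
    using measure_pmf.prob_compl[of ?A p] by (simp add: Compl_eq_Diff_UNIV)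
  ultimately show ?thesis using Q tv_dist_ge_diff[OF fin, of ?A] by simp
qed

text \<open>Expanding the square of the increment and inserting the eigenvalue gives, for one step
  from x to y, E \<Phi>(y)^2 = (1 - 2 \<gamma>) \<Phi>(x)^2 + E (\<Phi>(y) - \<Phi>(x))^2. The
  resulting recursion has the fixed point R / (2 \<gamma>), which serves as the variance
  bound.\<close>

lemma eigenfunction_moments:
  fixes \<Phi> :: "'a \<Rightarrow> real"
  assumes fin: "finite S" "set_pmf p \<subseteq> S" "\<And>x. x \<in> S \<Longrightarrow> set_pmf (K x) \<subseteq> S"
    and eig: "\<And>x. x \<in> S \<Longrightarrow> measure_pmf.expectation (K x) \<Phi> = (1 - \<gamma>) * \<Phi> x"
    and var: "\<And>x. x \<in> S \<Longrightarrow> measure_pmf.expectation (K x) (\<lambda>y. (\<Phi> y - \<Phi> x)\<^sup>2) \<le> R"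
  shows "measure_pmf.expectation (bind_pmf p K) \<Phi> = (1 - \<gamma>) * measure_pmf.expectation p \<Phi>"
    and "measure_pmf.expectation (bind_pmf p K) (\<lambda>x. (\<Phi> x)\<^sup>2)
           \<le> (1 - 2 * \<gamma>) * measure_pmf.expectation p (\<lambda>x. (\<Phi> x)\<^sup>2) + R"
proof -
  have finK: "finite (set_pmf (K x))" if "x \<in> S" for x using fin that finite_subset by blast
  have bind: "measure_pmf.expectation (bind_pmf p K) f
      = (\<Sum>x\<in>S. pmf p x * measure_pmf.expectation (K x) f)" for f :: "'a \<Rightarrow> real"
    using fin finK by (subst pmf_expectation_bind[where A = S]) auto
  have E: "measure_pmf.expectation p f = (\<Sum>x\<in>S. pmf p x * f x)" for f :: "'a \<Rightarrow> real"
    using fin by (subst integral_measure_pmf[where A = S]) auto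
  show "measure_pmf.expectation (bind_pmf p K) \<Phi> = (1 - \<gamma>) * measure_pmf.expectation p \<Phi>"
    by (simp add: bind E eig sum_distrib_left mult_ac)
  have sq: "measure_pmf.expectation (K x) (\<lambda>y. (\<Phi> y)\<^sup>2) \<le> (1 - 2 * \<gamma>) * (\<Phi> x)\<^sup>2 + R"
    if x: "x \<in> S" for x
  proof -
    note [simp] = integrable_measure_pmf_finite[OF finK[OF x]]
    have "measure_pmf.expectation (K x) (\<lambda>y. (\<Phi> y - \<Phi> x)\<^sup>2)
        = measure_pmf.expectation (K x) (\<lambda>y. (\<Phi> y)\<^sup>2 - 2 * \<Phi> x * \<Phi> y + (\<Phi> x)\<^sup>2)"
      by (simp add: power2_diff algebra_simps)
    also have "\<dots> = measure_pmf.expectation (K x) (\<lambda>y. (\<Phi> y)\<^sup>2) - 2 * \<Phi> x * ((1 - \<gamma>) * \<Phi> x) + (\<Phi> x)\<^sup>2"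
      by (simp add: eig[OF x])
    finally show ?thesis using var[OF x] by (simp add: algebra_simps power2_eq_square)
  qed
  have "measure_pmf.expectation (bind_pmf p K) (\<lambda>x. (\<Phi> x)\<^sup>2)
      \<le> (\<Sum>x\<in>S. pmf p x * ((1 - 2 * \<gamma>) * (\<Phi> x)\<^sup>2 + R))"
    unfolding bind by (intro sum_mono mult_left_mono sq) auto
  also have "\<dots> = (1 - 2 * \<gamma>) * measure_pmf.expectation p (\<lambda>x. (\<Phi> x)\<^sup>2) + R * (\<Sum>x\<in>S. pmf p x)"
    by (simp add: E sum_distrib_left algebra_simps sum.distrib sum_subtractf)
  finally show "measure_pmf.expectation (bind_pmf p K) (\<lambda>x. (\<Phi> x)\<^sup>2)
           \<le> (1 - 2 * \<gamma>) * measure_pmf.expectation p (\<lambda>x. (\<Phi> x)\<^sup>2) + R"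
    using fin by (simp add: sum_pmf_eq_1)
qed

section \<open>The sine-weighted height as an eigenfunction\<close>

text \<open>With \<open>c\<close> the density b / n of ones, the height vanishes at both ends of a
  path, as the summation by parts requires.\<close>

definition height :: "real \<Rightarrow> bool list \<Rightarrow> nat \<Rightarrow> real" where
  "height c xs i = (\<Sum>j<i. of_bool (xs ! j) - c)"

text \<open>The indices \<open>Suc i\<close> run over the interior points 1, ..., n - 1. The weight
  is the lowest Dirichlet eigenvector of the discrete Laplacian on 0, ..., n.\<close>

definition wilson :: "nat \<Rightarrow> real \<Rightarrow> bool list \<Rightarrow> real" where
  "wilson n c xs = (\<Sum>i<n - 1. sin (pi * Suc i / n) * height c xs (Suc i))"

text \<open>Only the prefix of length \<open>Suc i\<close> separates the two exchanged letters: it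
  trades the left one for the right one.\<close>

lemma height_swap_pair:
  assumes "Suc i < length xs" "k \<le> length xs"
  shows "height c (swap_pair i xs) k = height c xs k +
     (if k = Suc i then of_bool (xs ! Suc i) - of_bool (xs ! i) else 0)"
  using assms(2)
proof (induction k)
  case 0
  then show ?case by (simp add: height_def)
next
  case (Suc k)
  have "height c (swap_pair i xs) (Suc k) = height c (swap_pair i xs) k + of_bool (swap_pair i xs ! k) - c"
    and "height c xs (Suc k) = height c xs k + of_bool (xs ! k) - c"
    by (simp_all add: height_def)
  then show ?case using Suc assms(1) by (auto simp: nth_swap_pair)
qed

lemma wilson_swap_pair:
  assumes "Suc i < length xs" "length xs = n"
  shows "wilson n c (swap_pair i xs) = wilson n c xs +
     sin (pi * Suc i / n) * (of_bool (xs ! Suc i) - of_bool (xs ! i))"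
proof -
  have "wilson n c (swap_pair i xs) = (\<Sum>k<n - 1. sin (pi * Suc k / n) * height c xs (Suc k) +
     (if k = i then sin (pi * Suc i / n) * (of_bool (xs ! Suc i) - of_bool (xs ! i)) else 0))"
    unfolding wilson_def using assms
    by (intro sum.cong refl) (auto simp: height_swap_pair distrib_left)
  moreover have "i < n - 1" using assms by simp
  ultimately show ?thesis by (simp add: sum.distrib wilson_def)
qed

text \<open>Summation by parts; the summand telescopes as a difference of Casoratians.\<close>

lemma sum_casoratian:
  fixes f g :: "nat \<Rightarrow> real"
  shows "(\<Sum>i<N. f (Suc i) * (g i + g (i + 2))) = (\<Sum>i<N. g (Suc i) * (f i + f (i + 2)))
     + (f 1 * g 0 - g 1 * f 0) - (f (Suc N) * g N - g (Suc N) * f N)"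
  by (induction N) (auto simp: algebra_simps)

text \<open>A letter difference is a second difference of the height. Summation by parts moves the
  second difference onto the sine, where it acts as multiplication by -2 (1 - cos (pi / n)).\<close>

lemma sum_sin_height:
  assumes n: "n \<ge> 2" and h: "height c xs n = 0"
  shows "(\<Sum>i<n - 1. sin (pi * Suc i / n) * (of_bool (xs ! Suc i) - of_bool (xs ! i)))
     = - 2 * (1 - cos (pi / n)) * wilson n c xs"
proof -
  let ?s = "\<lambda>i. sin (pi * real i / n)" and ?h = "height c xs"
  have *: "of_bool (xs ! Suc i) - of_bool (xs ! i) = ?h i + ?h (i + 2) - 2 * ?h (Suc i)" for i
    by (simp add: height_def)
  have s: "?s i + ?s (i + 2) = 2 * cos (pi / n) * ?s (Suc i)" for i
  proof -
    have "pi * real i / n = pi * Suc i / n - pi / n" "pi * real (i + 2) / n = pi * Suc i / n + pi / n"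
      using n by (auto simp: field_simps)
    then show ?thesis by (simp add: sin_diff sin_add)
  qed
  \<comment> \<open>The Casoratian boundary terms vanish because sine and height are both zero at 0
    and at n.\<close>
  have "(\<Sum>i<n - 1. ?s (Suc i) * (?h i + ?h (i + 2))) = (\<Sum>i<n - 1. ?h (Suc i) * (?s i + ?s (i + 2)))"
    using n h by (subst sum_casoratian) (simp add: height_def)
  also have "\<dots> = 2 * cos (pi / n) * wilson n c xs"
    unfolding s wilson_def by (simp add: sum_distrib_left mult_ac)
  finally show ?thesis
    unfolding * by (simp add: algebra_simps sum.distrib sum_subtractf wilson_def sum_distrib_left)
qed

lemma sum_of_bool_nth:
  "(\<Sum>j<length xs. of_bool (xs ! j)) = real (count_list xs True)"
  "(\<Sum>j<length xs. of_bool (\<not> xs ! j)) = real (count_list xs False)"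
  by (induction xs) (simp_all add: sum.lessThan_Suc_shift del: sum.lessThan_Suc sum_of_bool_eq)

lemma height_end:
  assumes "xs \<in> lattice_paths a b" "a + b > 0"
  shows "height (b / real (a + b)) xs (a + b) = 0"
  using assms sum_of_bool_nth(1)[of xs] by (auto simp: height_def lattice_paths_def sum_subtractf)

text \<open>Each unequal adjacent pair contains a one, and each one lies in at most two pairs; the
  same holds for zeros.\<close>

lemma sum_letter_changes:
  assumes "xs \<in> lattice_paths a b"
  shows "(\<Sum>i<a + b - 1. (of_bool (xs ! Suc i) - of_bool (xs ! i))\<^sup>2) \<le> 2 * real (min a b)"
proof -
  have len: "length xs = a + b" and c: "count_list xs False = a" "count_list xs True = b"
    using assms by (auto simp: lattice_paths_def)
  \<comment> \<open>Every index occurs at most twice on the left, once as \<open>i\<close> and once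
    as \<open>Suc i\<close>.\<close>
  have 1: "(\<Sum>i<N - 1. f (Suc i) + f i) \<le> 2 * (\<Sum>i<N. f i)"
    if "\<And>i. f i \<ge> 0" for f :: "nat \<Rightarrow> real" and N
  proof (cases N)
    case (Suc k)
    then show ?thesis
      using that[of 0] that[of k] sum.lessThan_Suc_shift[of f k] by (simp add: sum.distrib)
  qed simp
  have "(\<Sum>i<a + b - 1. (of_bool (xs ! Suc i) - of_bool (xs ! i))\<^sup>2)
      \<le> (\<Sum>i<a + b - 1. of_bool (xs ! Suc i) + of_bool (xs ! i) :: real)"
    by (intro sum_mono) auto
  also have "\<dots> \<le> 2 * real b"
    using 1[of "\<lambda>i. of_bool (xs ! i)" "a + b"] sum_of_bool_nth(1)[of xs] by (simp add: len c)
  finally have B: "(\<Sum>i<a + b - 1. (of_bool (xs ! Suc i) - of_bool (xs ! i))\<^sup>2) \<le> 2 * real b" .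
  have "(\<Sum>i<a + b - 1. (of_bool (xs ! Suc i) - of_bool (xs ! i))\<^sup>2)
      \<le> (\<Sum>i<a + b - 1. of_bool (\<not> xs ! Suc i) + of_bool (\<not> xs ! i) :: real)"
    by (intro sum_mono) auto
  also have "\<dots> \<le> 2 * real a"
    using 1[of "\<lambda>i. of_bool (\<not> xs ! i)" "a + b"] sum_of_bool_nth(2)[of xs] by (simp add: len c)
  finally show ?thesis using B by (simp add: min_def)
qed

text \<open>Averaged over coin and position, the increment is the sum evaluated in
  \<open>sum_sin_height\<close>, divided by 2 (n - 1).\<close>

lemma wilson_eigenfunction:
  assumes x: "xs \<in> lattice_paths a b" and n: "n = a + b" "n \<ge> 2"
  shows "measure_pmf.expectation (path_step xs) (wilson n (b / n))
    = (1 - (1 - cos (pi / n)) / (n - 1)) * wilson n (b / n) xs"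
proof -
  let ?w = "wilson n (b / n)"
  have len: "length xs = n" using x n by (simp add: lattice_paths_def)
  have "0 < a + b" using n by linarith
  then have h: "height (b / n) xs n = 0" unfolding n(1) by (rule height_end[OF x])
  have "(\<Sum>i<n - 1. (?w xs + ?w (swap_pair i xs)) / 2)
     = (\<Sum>i<n - 1. ?w xs + sin (pi * Suc i / n) * (of_bool (xs ! Suc i) - of_bool (xs ! i)) / 2)"
    by (intro sum.cong refl) (simp add: wilson_swap_pair len)
  also have "\<dots> = real (n - 1) * ?w xs - (1 - cos (pi / n)) * ?w xs"
    unfolding sum.distrib sum_divide_distrib[symmetric] sum_sin_height[OF n(2) h]
    by (simp add: field_simps)
  finally show ?thesis
    using n(2) by (subst expectation_path_step) (simp_all add: len field_simps of_nat_diff)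
qed

text \<open>The sine is at most 1 in modulus and the coin halves the sum, so the at most
  \<open>2 * min a b\<close> unequal pairs contribute at most \<open>min a b\<close>.\<close>

lemma wilson_increment:
  assumes x: "xs \<in> lattice_paths a b" and n: "n = a + b" "n \<ge> 2"
  shows "measure_pmf.expectation (path_step xs) (\<lambda>y. (wilson n c y - wilson n c xs)\<^sup>2)
    \<le> real (min a b) / (real n - 1)"
proof -
  let ?w = "wilson n c"
  have len: "length xs = n" using x n by (simp add: lattice_paths_def)
  have "(\<Sum>i<n - 1. ((?w xs - ?w xs)\<^sup>2 + (?w (swap_pair i xs) - ?w xs)\<^sup>2) / 2)
     \<le> (\<Sum>i<n - 1. (of_bool (xs ! Suc i) - of_bool (xs ! i))\<^sup>2 / 2)"
  proof (intro sum_mono)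
    fix i assume "i \<in> {..<n - 1}"
    then have "?w (swap_pair i xs) - ?w xs = sin (pi * Suc i / n) * (of_bool (xs ! Suc i) - of_bool (xs ! i))"
      by (simp add: wilson_swap_pair len)
    moreover have "(sin (pi * Suc i / n))\<^sup>2 * (of_bool (xs ! Suc i) - of_bool (xs ! i))\<^sup>2
        \<le> 1 * (of_bool (xs ! Suc i) - of_bool (xs ! i) :: real)\<^sup>2"
      by (intro mult_right_mono) (auto simp: abs_square_le_1)
    ultimately show "((?w xs - ?w xs)\<^sup>2 + (?w (swap_pair i xs) - ?w xs)\<^sup>2) / 2
        \<le> (of_bool (xs ! Suc i) - of_bool (xs ! i))\<^sup>2 / 2"
      by (simp add: power_mult_distrib)
  qed
  also have "\<dots> \<le> real (min a b)"
    using sum_letter_changes[OF x] n by (simp add: sum_divide_distrib[symmetric])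
  finally show ?thesis
    using n(2) by (subst expectation_path_step) (simp_all add: len divide_right_mono of_nat_diff)
qed

section \<open>Trigonometric bounds and the initial value of the eigenfunction\<close>

text \<open>Jordan's inequality: sine is concave here, hence above the chord joining its end
  points.\<close>

lemma sin_ge_two_over_pi:
  assumes "0 \<le> x" "x \<le> pi / 2"
  shows "sin x \<ge> 2 / pi * x"
proof -
  have "concave_on {0..pi / 2} sin"
  proof (rule f''_le0_imp_concave)
    show "DERIV sin x :> cos x" "DERIV cos x :> - sin x" for x :: real by auto
    show "- sin x \<le> 0" if "x \<in> {0..pi / 2}" for x
      using that by (auto intro!: sin_ge_zero)
  qed auto
  from concave_onD_Icc'[OF this, of x] show ?thesis using assms by simp
qed

text \<open>Jordan's inequality for i up to n / 2, reflected by sin (pi - x) = sin x for the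
  rest.\<close>

lemma sin_ge_min:
  assumes "i \<le> n" "n > 0"
  shows "sin (pi * real i / n) \<ge> 2 * real (min i (n - i)) / n"
proof (cases "2 * i \<le> n")
  case True
  then have "2 * real i \<le> real n" by linarith
  then have "pi * real i / n \<le> pi / 2" using assms by (simp add: field_simps)
  then show ?thesis using sin_ge_two_over_pi[of "pi * real i / n"] True by (simp add: min_def)
next
  case False
  then have "2 * real (n - i) \<le> real n" by linarith
  then have "pi * real (n - i) / n \<le> pi / 2" using assms by (simp add: field_simps)
  moreover have "pi * real (n - i) / n = pi - pi * real i / n"
    using assms by (simp add: field_simps of_nat_diff)
  moreover from this have "sin (pi * real (n - i) / n) = sin (pi * real i / n)"
    by (metis sin_pi_minus)
  moreover have "min i (n - i) = n - i" using False by simp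
  moreover have "2 / pi * (pi * real (n - i) / n) = 2 * real (n - i) / n" by simp
  ultimately show ?thesis
    using sin_ge_two_over_pi[of "pi * real (n - i) / n"] by (metis divide_nonneg_nonneg mult_nonneg_nonneg of_nat_0_le_iff pi_ge_zero)
qed

text \<open>Both follow from 1 - cos x = 2 (sin (x / 2))^2, with Jordan's inequality from below and
  sin x \<le> x from above. The lower bound controls the variance; the upper one, asymptotically
  exact, controls the decay rate.\<close>

lemma one_minus_cos_bounds:
  assumes "n \<ge> (1::nat)"
  shows "1 - cos (pi / n) \<ge> 2 / (real n)\<^sup>2" "1 - cos (pi / n) \<le> pi\<^sup>2 / (2 * (real n)\<^sup>2)"
proof -
  have *: "1 - cos (pi / n) = 2 * (sin (pi / n / 2))\<^sup>2"
    using cos_double_sin[of "pi / n / 2"] by simp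
  have "pi / n / 2 \<le> pi / 2" using assms by (simp add: field_simps)
  then have s: "1 / n \<le> sin (pi / n / 2)"
    using sin_ge_two_over_pi[of "pi / n / 2"] by simp
  then have "(1 / n)\<^sup>2 \<le> (sin (pi / n / 2))\<^sup>2" by (intro power_mono) auto
  then show "1 - cos (pi / n) \<ge> 2 / (real n)\<^sup>2" unfolding * by (simp add: power_divide)
  have "sin (pi / n / 2) \<le> pi / n / 2" by (intro sin_x_le_x) auto
  moreover have "0 \<le> sin (pi / n / 2)" using s by (smt (verit) divide_nonneg_nonneg of_nat_0_le_iff)
  ultimately have "(sin (pi / n / 2))\<^sup>2 \<le> (pi / n / 2)\<^sup>2" by (intro power_mono)
  then show "1 - cos (pi / n) \<le> pi\<^sup>2 / (2 * (real n)\<^sup>2)"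
    unfolding * by (simp add: power_divide field_simps)
qed

definition top_path :: "nat \<Rightarrow> nat \<Rightarrow> bool list" where
  "top_path a b = replicate b True @ replicate a False"

lemma top_path_mem: "top_path a b \<in> lattice_paths a b"
proof -
  have "count_list (replicate n x) y = (if x = y then n else 0)" for n and x y :: bool
    by (induction n) auto
  then show ?thesis by (simp add: lattice_paths_def top_path_def)
qed

lemma height_top_path:
  assumes "k \<le> a + b"
  shows "height c (top_path a b) k = real (min k b) - real k * c"
  using assms
proof (induction k)
  case (Suc k)
  have "height c (top_path a b) (Suc k) = height c (top_path a b) k + of_bool (top_path a b ! k) - c"
    by (simp add: height_def)
  moreover have "top_path a b ! k \<longleftrightarrow> k < b"
    using Suc.prems by (simp add: top_path_def nth_append)
  ultimately show ?case using Suc by (auto simp: algebra_simps min_def of_nat_diff)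
qed (simp add: height_def)

text \<open>The height of this path is a tent: k a / n up to k = b, and (n - k) b / n
  beyond.\<close>

lemma height_top_path_ge:
  assumes "k \<le> a + b" "a + b > 0"
  shows "height (b / real (a + b)) (top_path a b) k
    \<ge> real (min a b) * real (min k (a + b - k)) / real (a + b)"
proof -
  have "height (b / real (a + b)) (top_path a b) k =
     (if k \<le> b then real a * real k else real b * real (a + b - k)) / real (a + b)"
  proof -
    have "real a + real b > 0" using assms(2) by linarith
    then show ?thesis
      using assms(1) by (auto simp: height_top_path divide_simps of_nat_diff) (auto simp: algebra_simps)
  qed
  also have "\<dots> \<ge> real (min a b) * real (min k (a + b - k)) / real (a + b)"
    by (auto intro!: divide_right_mono mult_mono)
  finally show ?thesis .
qed

lemma sum_squares_ge: "(\<Sum>i<N. (real (Suc i))\<^sup>2) \<ge> real N ^ 3 / 3"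
  by (induction N) (auto simp: power2_eq_square power3_eq_cube algebra_simps)

text \<open>Sine and height dominate the tent min k (n - k) scaled by 2 / n and by min a b / n
  respectively, so a sum of squares of the tent remains. Only the order of magnitude matters
  later.\<close>

lemma wilson_top_path:
  assumes "n = a + b" "n \<ge> 2"
  shows "wilson n (b / n) (top_path a b) \<ge> 2 * real (min a b) * n / 81"
proof -
  let ?m = "real (min a b)" and ?k = "\<lambda>i. real (min (Suc i) (n - Suc i))"
  define N where "N = n div 2"
  \<comment> \<open>The tent is summed over its rising half only. The bound N \<ge> n / 3, attained
    at n = 3, gives (n / 3)^3 / 3, which is the source of the constant 81.\<close>
  have "n \<le> 3 * N" using assms(2) unfolding N_def by presburger
  then have N: "real n / 3 \<le> real N" by linarith
  have "(real n / 3) ^ 3 / 3 \<le> real N ^ 3 / 3"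
    using N by (intro divide_right_mono power_mono) auto
  also have "\<dots> \<le> (\<Sum>i<N. (real (Suc i))\<^sup>2)"
    by (rule sum_squares_ge)
  also have "\<dots> = (\<Sum>i<N. (?k i)\<^sup>2)"
    by (intro sum.cong refl arg_cong[where f = "\<lambda>x. (real x)\<^sup>2"]) (auto simp: N_def min_def)
  also have "\<dots> \<le> (\<Sum>i<n - 1. (?k i)\<^sup>2)"
    using assms(2) by (intro sum_mono2) (auto simp: N_def)
  finally have k: "(real n / 3) ^ 3 / 3 \<le> (\<Sum>i<n - 1. (?k i)\<^sup>2)" .
  have "2 * ?m * n / 81 = 2 * ?m / (real n)\<^sup>2 * ((real n / 3) ^ 3 / 3)"
    using assms(2) by (simp add: power2_eq_square power3_eq_cube)
  also have "\<dots> \<le> 2 * ?m / (real n)\<^sup>2 * (\<Sum>i<n - 1. (?k i)\<^sup>2)"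
    using k by (intro mult_left_mono) auto
  also have "\<dots> = (\<Sum>i<n - 1. (2 * ?k i / n) * (?m * ?k i / n))"
    by (simp add: sum_distrib_left power2_eq_square mult_ac)
  also have "\<dots> \<le> wilson n (b / n) (top_path a b)"
    unfolding wilson_def
  proof (intro sum_mono mult_mono)
    fix i assume i: "i \<in> {..<n - 1}"
    show s: "2 * ?k i / n \<le> sin (pi * Suc i / n)"
      using sin_ge_min[of "Suc i" n] i assms(2) by auto
    show "?m * ?k i / n \<le> height (b / n) (top_path a b) (Suc i)"
      unfolding assms(1) by (rule height_top_path_ge) (use i assms in auto)
    show "0 \<le> sin (pi * Suc i / n)" using s by (rule order_trans[rotated]) simp
  qed simp
  finally show ?thesis .
qed

section \<open>Distance from uniformity in terms of the decay rate, and its asymptotics\<close>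

text \<open>The second moment comparison is applied with \<mu> equal to (1 - \<gamma>)^t times the
  initial value, which is at least 2 m n / 81, and with V = R / (2 \<gamma>) \<le> m n^2 /
  4.\<close>

lemma path_dist_ge:
  fixes a b t :: nat
  defines "n \<equiv> a + b" and "m \<equiv> min a b"
  defines "\<gamma> \<equiv> (1 - cos (pi / n)) / (real n - 1)"
  assumes m: "m \<ge> 1" and n: "n \<ge> 4" and \<gamma>: "\<gamma> \<le> 1 / 2"
  shows "path_dist a b t \<ge> 1 - 81\<^sup>2 / 2 / (real m * (1 - \<gamma>) ^ (2 * t))"
proof -
  let ?S = "lattice_paths a b" and ?x = "top_path a b" and ?\<Phi> = "wilson n (b / n)"
  define U where "U = pmf_of_set ?S"
  define R where "R = real m / (real n - 1)"
  let ?V = "R / (2 * \<gamma>)"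
  have nab: "n = a + b" by (simp add: n_def)
  have ab: "a + b \<ge> 2" "n \<ge> 2" using n n_def by auto
  have cos: "1 - cos (pi / n) \<ge> 2 / (real n)\<^sup>2" using one_minus_cos_bounds(1)[of n] n by simp
  then have cos0: "1 - cos (pi / n) > 0" using n by (smt (verit) divide_pos_pos of_nat_0_less_iff zero_less_power not_numeral_le_zero not_gr_zero)
  then have \<gamma>0: "\<gamma> > 0" using n by (simp add: \<gamma>_def)
  \<comment> \<open>The factors n - 1 in \<open>R\<close> and in \<gamma> cancel.\<close>
  have V: "?V \<le> real m * (real n)\<^sup>2 / 4"
  proof -
    have "?V = real m / (2 * (1 - cos (pi / n)))" using n by (simp add: R_def \<gamma>_def)
    also have "\<dots> \<le> real m / (2 * (2 / (real n)\<^sup>2))"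
      using cos n cos0 by (intro divide_left_mono mult_left_mono) (auto intro!: mult_pos_pos)
    finally show ?thesis by simp
  qed
  have closed: "\<And>x. x \<in> ?S \<Longrightarrow> set_pmf (path_step x) \<subseteq> ?S"
    by (rule set_path_step[OF _ ab(1)])
  have eig: "\<And>x. x \<in> ?S \<Longrightarrow> measure_pmf.expectation (path_step x) ?\<Phi> = (1 - \<gamma>) * ?\<Phi> x"
    unfolding \<gamma>_def by (rule wilson_eigenfunction[OF _ nab ab(2)])
  have inc: "\<And>x. x \<in> ?S \<Longrightarrow> measure_pmf.expectation (path_step x) (\<lambda>y. (?\<Phi> y - ?\<Phi> x)\<^sup>2) \<le> R"
    unfolding R_def m_def by (rule wilson_increment[OF _ nab ab(2)])
  note step = eigenfunction_moments[OF finite_lattice_paths _ closed eig inc]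
  note law = set_path_law[OF top_path_mem ab(1)]
  have mean: "measure_pmf.expectation (path_law ?x t) ?\<Phi> = (1 - \<gamma>) ^ t * ?\<Phi> ?x" for t
    by (induction t) (use step(1)[OF law] in auto)
  have var: "measure_pmf.expectation (path_law ?x t) (\<lambda>x. (?\<Phi> x)\<^sup>2) \<le> ((1 - \<gamma>) ^ t * ?\<Phi> ?x)\<^sup>2 + ?V" for t
  proof (induction t)
    case 0
    have "?V \<ge> 0" using \<gamma>0 n by (auto simp: R_def)
    then show ?case by simp
  next
    case (Suc t)
    let ?\<mu> = "(1 - \<gamma>) ^ t * ?\<Phi> ?x"
    have "measure_pmf.expectation (path_law ?x (Suc t)) (\<lambda>x. (?\<Phi> x)\<^sup>2)
       \<le> (1 - 2 * \<gamma>) * measure_pmf.expectation (path_law ?x t) (\<lambda>x. (?\<Phi> x)\<^sup>2) + R"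
      using step(2)[OF law] by simp
    also have "\<dots> \<le> (1 - 2 * \<gamma>) * (?\<mu>\<^sup>2 + ?V) + R"
      using \<gamma> Suc by (intro add_right_mono mult_left_mono) auto
    also have "\<dots> = (1 - 2 * \<gamma>) * ?\<mu>\<^sup>2 + ?V" using \<gamma>0 by (simp add: field_simps)
    \<comment> \<open>Since 1 - 2 \<gamma> \<le> (1 - \<gamma>)^2, the new squared mean absorbs the
      first term, while \<open>?V\<close>, the fixed point of the recursion, is reproduced.\<close>
    also have "\<dots> \<le> (1 - \<gamma>)\<^sup>2 * ?\<mu>\<^sup>2 + ?V"
      by (intro add_right_mono mult_right_mono) (auto simp: power2_diff)
    also have "\<dots> = ((1 - \<gamma>) ^ Suc t * ?\<Phi> ?x)\<^sup>2 + ?V" by (simp add: power_mult_distrib)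
    finally show ?case .
  qed
  have SU: "set_pmf U = ?S" unfolding U_def by (simp add: finite_lattice_paths lattice_paths_nonempty)
  \<comment> \<open>By stationarity the same expectation stands on both sides; solving for it gives
    R / (2 \<gamma>).\<close>
  have "measure_pmf.expectation U (\<lambda>x. (?\<Phi> x)\<^sup>2) \<le> (1 - 2 * \<gamma>) * measure_pmf.expectation U (\<lambda>x. (?\<Phi> x)\<^sup>2) + R"
    using step(2)[of U] uniform_stationary[OF ab(1)] SU by (simp add: U_def)
  then have varU: "measure_pmf.expectation U (\<lambda>x. (?\<Phi> x)\<^sup>2) \<le> ?V" using \<gamma>0 by (simp add: field_simps)
  have \<Phi>: "?\<Phi> ?x \<ge> 2 * real m * n / 81"
    using wilson_top_path[OF nab ab(2)] by (simp add: m_def)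
  have low: "2 * real m * n / 81 > 0" using m n by simp
  have pos: "?\<Phi> ?x > 0" using \<Phi> low by linarith
  have \<gamma>1: "(1 - \<gamma>) > 0" using \<gamma> by simp
  have "1 - 8 * ?V / ((1 - \<gamma>) ^ t * ?\<Phi> ?x)\<^sup>2 \<le> tv_dist (path_law ?x t) U"
    by (rule tv_dist_ge_second_moment[OF finite_lattice_paths law _ mean _ var varU])
       (use SU pos \<gamma>1 in auto)
  also have "\<dots> \<le> path_dist a b t"
    unfolding path_dist_def U_def by (intro Max_ge finite_imageI imageI finite_lattice_paths top_path_mem)
  finally have *: "1 - 8 * ?V / ((1 - \<gamma>) ^ t * ?\<Phi> ?x)\<^sup>2 \<le> path_dist a b t" .
  have "8 * ?V / ((1 - \<gamma>) ^ t * ?\<Phi> ?x)\<^sup>2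
      \<le> 8 * (real m * (real n)\<^sup>2 / 4) / ((1 - \<gamma>) ^ t * (2 * real m * n / 81))\<^sup>2"
  proof (rule frac_le)
    show "8 * ?V \<le> 8 * (real m * (real n)\<^sup>2 / 4)" using V by (rule mult_left_mono) simp
    show "0 < ((1 - \<gamma>) ^ t * (2 * real m * n / 81))\<^sup>2"
      using low \<gamma>1 by (intro zero_less_power mult_pos_pos)
    show "((1 - \<gamma>) ^ t * (2 * real m * n / 81))\<^sup>2 \<le> ((1 - \<gamma>) ^ t * ?\<Phi> ?x)\<^sup>2"
      using \<Phi> low \<gamma>1 by (intro power_mono mult_left_mono mult_nonneg_nonneg) auto
  qed simp
  also have "\<dots> = 81\<^sup>2 / 2 / (real m * (1 - \<gamma>) ^ (2 * t))"
  proof -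
    have "8 * (u * v\<^sup>2 / 4) / (z * (2 * u * v / 81))\<^sup>2 = 81\<^sup>2 / 2 / (u * z\<^sup>2)"
      if "u \<noteq> 0" "v \<noteq> 0" "z \<noteq> 0" for u v z :: real
      using that by (simp add: divide_simps power2_eq_square)
    then show ?thesis using m n \<gamma>1 unfolding power_even_eq by simp
  qed
  finally show ?thesis using * by linarith
qed

text \<open>From -ln (1 - \<gamma>) \<le> \<gamma> / (1 - \<gamma>) and \<gamma> \<le> pi^2 / (2 n^2
  (n - 1)), the exponent is at most (1 - \<eta>) (n / (n - 1))^2 ln m. Half of \<eta> pays for the
  ratio n / (n - 1), which is where n \<ge> 4 / \<eta> enters.\<close>

lemma gap_power_ge:
  fixes n m t :: nat and \<eta> :: real
  defines "\<gamma> \<equiv> (1 - cos (pi / n)) / (real n - 1)"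
  assumes n: "n \<ge> 4" "real n \<ge> 4 / \<eta>" and m: "m \<ge> 1" and \<eta>: "0 < \<eta>" "\<eta> < 1"
    and t: "real t \<le> (1 - \<eta>) / pi\<^sup>2 * real n ^ 3 * ln (real m)"
  shows "\<gamma> \<le> 1 / 2" "(1 - \<gamma>) ^ (2 * t) \<ge> real m powr (\<eta> / 2 - 1)"
proof -
  define r where "r = real n"
  have r: "r \<ge> 4" "r \<ge> 4 / \<eta>" using n by (auto simp: r_def)
  have cos: "1 - cos (pi / n) \<le> pi\<^sup>2 / (2 * r\<^sup>2)" using one_minus_cos_bounds(2)[of n] n by (simp add: r_def)
  have "\<gamma> \<le> pi\<^sup>2 / (2 * r\<^sup>2) / (r - 1)"
    using divide_right_mono[OF cos, of "r - 1"] r by (simp add: \<gamma>_def r_def)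
  then have \<gamma>u: "\<gamma> \<le> pi\<^sup>2 / (2 * r\<^sup>2 * (r - 1))" by simp
  have \<gamma>0: "\<gamma> \<ge> 0" unfolding \<gamma>_def using n by auto
  have "pi\<^sup>2 \<le> 4\<^sup>2" using pi_less_4 by (intro power_mono) auto
  moreover have "4 * 3 \<le> r * (r - 1)" using r by (intro mult_mono) auto
  ultimately have "pi\<^sup>2 \<le> 2 * (r * (r - 1))" by simp
  then have "pi\<^sup>2 / (2 * r\<^sup>2 * (r - 1)) \<le> 2 * (r * (r - 1)) / (2 * r\<^sup>2 * (r - 1))"
    using r by (intro divide_right_mono) auto
  also have "\<dots> = 1 / r" using r by (simp add: power2_eq_square)
  finally have "pi\<^sup>2 / (2 * r\<^sup>2 * (r - 1)) \<le> 1 / r" .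
  then have \<gamma>r: "\<gamma> \<le> 1 / r" using \<gamma>u by simp
  also have "1 / r \<le> 1 / 4" using r by (intro divide_left_mono) auto
  finally have \<gamma>4: "\<gamma> \<le> 1 / 4" .
  then show "\<gamma> \<le> 1 / 2" by simp
  have "\<gamma> / (1 - \<gamma>) \<le> pi\<^sup>2 / (2 * r\<^sup>2 * (r - 1)) / (1 - 1 / r)"
    using r \<gamma>u \<gamma>r \<gamma>4 \<gamma>0 by (intro frac_le) auto
  also have "\<dots> = pi\<^sup>2 / (2 * r * (r - 1)\<^sup>2)"
  proof -
    have "2 * r\<^sup>2 * (r - 1) * (1 - 1 / r) = 2 * r * (r - 1)\<^sup>2"
      using r by (simp add: field_simps power2_eq_square)
    then show ?thesis by (simp only: divide_divide_eq_left)
  qed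
  finally have g: "\<gamma> / (1 - \<gamma>) \<le> pi\<^sup>2 / (2 * r * (r - 1)\<^sup>2)" .
  have L: "ln (real m) \<ge> 0" using m by simp
  \<comment> \<open>The aim is the inequality \<open>q\<close> below. In the difference of its sides
    the gain \<eta> r^2 / 2 covers the loss 2 r exactly when r \<ge> 4 / \<eta>.\<close>
  have "4 \<le> r * \<eta>" using r \<eta> by (simp add: field_simps)
  then have "4 * r \<le> r * \<eta> * r" using r by (intro mult_right_mono) auto
  then have "0 \<le> (r * \<eta> * r - 4 * r) / 2" by simp
  moreover have "0 \<le> \<eta> * (r - 1 / 2)" using r \<eta> by (intro mult_nonneg_nonneg) auto
  ultimately have "0 \<le> (r * \<eta> * r - 4 * r) / 2 + \<eta> * (r - 1 / 2) + 1"
    by (intro add_nonneg_nonneg) auto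
  also have "\<dots> = (1 - \<eta> / 2) * (r - 1)\<^sup>2 - (1 - \<eta>) * r\<^sup>2"
    by (simp add: field_simps power2_eq_square)
  finally have q: "(1 - \<eta>) * r\<^sup>2 \<le> (1 - \<eta> / 2) * (r - 1)\<^sup>2" by simp
  have "2 * real t * (\<gamma> / (1 - \<gamma>))
      \<le> 2 * ((1 - \<eta>) / pi\<^sup>2 * r ^ 3 * ln (real m)) * (pi\<^sup>2 / (2 * r * (r - 1)\<^sup>2))"
    using t g \<eta> L \<gamma>0 \<gamma>4 r by (intro mult_mono mult_left_mono) (auto simp: r_def)
  also have "\<dots> = ((1 - \<eta>) * r\<^sup>2) / (r - 1)\<^sup>2 * ln (real m)"
  proof -
    have *: "2 * (u / p * r ^ 3 * l) * (p / (2 * r * q)) = u * r\<^sup>2 / q * l"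
      if "p \<noteq> 0" "q \<noteq> 0" for u p q l :: real
      using that r by (simp add: divide_simps power2_eq_square power3_eq_cube)
    show ?thesis by (rule *) (use r in auto)
  qed
  also have "\<dots> \<le> (1 - \<eta> / 2) * ln (real m)"
    using r L q by (intro mult_right_mono) (auto simp: pos_divide_le_eq)
  finally have e: "2 * real t * (\<gamma> / (1 - \<gamma>)) \<le> (1 - \<eta> / 2) * ln (real m)" .
  have "ln (1 / (1 - \<gamma>)) \<le> 1 / (1 - \<gamma>) - 1" using \<gamma>4 by (intro ln_le_minus_one) auto
  then have ln: "ln (1 - \<gamma>) \<ge> - (\<gamma> / (1 - \<gamma>))"
    using \<gamma>4 by (simp add: ln_div field_simps)
  have "real m powr (\<eta> / 2 - 1) = exp (- ((1 - \<eta> / 2) * ln (real m)))"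
    using m by (simp add: powr_def algebra_simps)
  also have "\<dots> \<le> exp (2 * real t * ln (1 - \<gamma>))"
    using e mult_left_mono[OF ln, of "2 * real t"] by simp
  also have "\<dots> = (1 - \<gamma>) ^ (2 * t)"
    using \<gamma>4 exp_of_nat_mult[of "2 * t" "ln (1 - \<gamma>)"] by simp
  finally show "(1 - \<gamma>) ^ (2 * t) \<ge> real m powr (\<eta> / 2 - 1)" .
qed

theorem theorem4:
  fixes \<eta> :: real
  assumes "0 < \<eta>" and "\<eta> < 1"
  shows "\<exists>M::nat. \<forall>a b t :: nat. min a b \<ge> M \<longrightarrow>
           real t \<le> (1 - \<eta>) / pi\<^sup>2 * real (a + b) ^ 3 * ln (real (min a b)) \<longrightarrow>
           path_dist a b t \<ge> 1 - \<eta>"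
proof -
  \<comment> \<open>\<open>C\<close> is the size of m (1 - \<gamma>)^(2 t) at which the error
    becomes \<eta>. The entries of \<open>M\<close> serve, in order, the bound \<gamma> \<le> 1 / 2,
    the ratio n / (n - 1), and \<open>m powr (\<eta> / 2) \<ge> C\<close>.\<close>
  define C :: real where "C = 81\<^sup>2 / 2 / \<eta>"
  define M where "M = nat \<lceil>max 4 (max (4 / \<eta>) (C powr (2 / \<eta>)))\<rceil>"
  have C: "C > 0" using assms by (simp add: C_def)
  show ?thesis
  proof (intro exI[of _ M] allI impI)
    fix a b t :: nat
    define n m where "n = a + b" and "m = min a b"
    assume "min a b \<ge> M" and t: "real t \<le> (1 - \<eta>) / pi\<^sup>2 * real (a + b) ^ 3 * ln (real (min a b))"
    then have "M \<le> m" by (simp only: m_def)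
    then have "max 4 (max (4 / \<eta>) (C powr (2 / \<eta>))) \<le> real m"
      unfolding M_def nat_ceiling_le_eq .
    then have m: "m \<ge> 4" "4 / \<eta> \<le> real m" "C powr (2 / \<eta>) \<le> real m" by auto
    have mn: "m \<le> n" by (simp add: m_def n_def)
    have n: "n \<ge> 4" "4 / \<eta> \<le> real n" using m mn by linarith+
    define \<gamma> where "\<gamma> = (1 - cos (pi / n)) / (real n - 1)"
    have m1: "m \<ge> 1" using m by simp
    note gap = gap_power_ge[OF n m1 assms t[folded n_def m_def], folded \<gamma>_def]
    have "C = (C powr (2 / \<eta>)) powr (\<eta> / 2)" using C assms by (simp add: powr_powr)
    also have "\<dots> \<le> real m powr (\<eta> / 2)" using m assms by (intro powr_mono2) auto
    also have "\<dots> = real m * real m powr (\<eta> / 2 - 1)" using m1 by (simp add: powr_diff)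
    also have "\<dots> \<le> real m * (1 - \<gamma>) ^ (2 * t)" using gap by (intro mult_left_mono) auto
    finally have "81\<^sup>2 / 2 / (real m * (1 - \<gamma>) ^ (2 * t)) \<le> 81\<^sup>2 / 2 / C"
      using C by (intro divide_left_mono) (auto intro!: mult_pos_pos)
    also have "\<dots> = \<eta>" using assms by (simp add: C_def)
    finally show "path_dist a b t \<ge> 1 - \<eta>"
      using path_dist_ge[of a b t, folded n_def m_def, folded \<gamma>_def, OF m1 n(1) gap(1)] by linarith
  qed
qed

end
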